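(* Let $M$ be an $S$-sorted pure clone and $\mathcal{K}$ a class of $M$-algebras. Then the variety $\mathcal{V}(\mathcal{K})$ generated by $\mathcal{K}$ coincides with $\mathbf{HSP}(\mathcal{K})$.
   Context: $S$ is a nonzero cardinal and $\kappa>S$ an infinite cardinal. An $S$-sorted $<\kappa$-ary clone $M$ consists of: for every cardinal $\lambda<\kappa$, map $v:\lambda\to S$ and $s\in S$ a set $M_{(\lambda,v,s)}$; projections $\pi_{(\lambda,v,i)}\in M_{(\lambda,v,v(i))}$; associative composition maps $M_{(\lambda_1,v_1,s)}\times\prod_{i\in\lambda_1}M_{(\lambda_2,v_2,v_1(i))}\to M_{(\lambda_2,v_2,s)}$ with projections as two-sided units. An $M$-algebra is a family $A=(A_s)_{s\in S}$ with maps $f^A:\prod_{i\in\lambda}A_{v(i)}\to A_s$ for $f\in M_{(\lambda,v,s)}$, projections acting as coordinate projections and composition as composition of maps. $M$ is pure if $M_{(1,v,s_2)}\ne\emptyset$ whenever $v(0)=s_1$, for all $s_1,s_2\in S$. $\mathcal{V}(\mathcal{K})$ is the class of all $M$-algebras $A$ such that $f^A=g^A$ for every pair $f,g\in M_{(\lambda,v,s)}$ with $f^B=g^B$ for all $B\in\mathcal{K}$. Subalgebras are sortwise subsets closed under all operations; homomorphic images are images under sortwise surjective homomorphisms; products are sortwise direct products (with coordinatewise operations). $\mathbf{H},\mathbf{S},\mathbf{P}$ denote closure (up to isomorphism) under homomorphic images, subalgebras and products respectively.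
   Formalization: The cardinal κ is additionally assumed regular, since the claim fails for singular κ (e.g. κ = ℵ_ω); and K is a set of algebras rather than a proper class, to which the general case reduces because the identities form a set. *)

theory Defs
  imports Main "HOL-Library.FuncSet"
begin

unbundle cardinal_syntax

text \<open>
  An infinite cardinal \<open>\<kappa>\<close> is a relation with \<open>Cinfinite \<kappa>\<close>. As with von Neumann ordinals, an
  element \<open>l\<close> of \<open>Field \<kappa>\<close> is an ordinal below \<open>\<kappa>\<close> whose underlying set is \<open>underS \<kappa> l\<close>; it is a
  cardinal iff it is an initial ordinal. The cardinal of sorts is a type \<open>'s\<close> (hence nonzero).
  Below, \<open>\<kappa>\<close> is also taken to be regular: for singular \<open>\<kappa>\<close> nested compositions may involve \<open>\<kappa>\<close> many
  variables, such compositions are not operations of the clone, and the HSP theorem fails.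
\<close>

definition cardinals_below :: "'k rel \<Rightarrow> 'k set" where
  "cardinals_below \<kappa> = {l \<in> Field \<kappa>. Card_order (Restr \<kappa> (underS \<kappa> l))}"

type_synonym ('k, 's) arity = "'k \<times> ('k \<Rightarrow> 's)"

definition arity_set :: "'k rel \<Rightarrow> ('k, 's) arity set" where
  "arity_set \<kappa> = {(l, v). l \<in> cardinals_below \<kappa> \<and> v \<in> underS \<kappa> l \<rightarrow>\<^sub>E UNIV}"

text \<open>The product of the sets \<open>X (v i)\<close>, \<open>i \<in> l\<close>, for an arity \<open>(l, v)\<close>.\<close>

definition tuples :: "'k rel \<Rightarrow> ('k, 's) arity \<Rightarrow> ('s \<Rightarrow> 'a set) \<Rightarrow> ('k \<Rightarrow> 'a) set" where
  "tuples \<kappa> a X = (\<Pi>\<^sub>E i\<in>underS \<kappa> (fst a). X (snd a i))"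

text \<open>
  \<open>ops M (l, v) s\<close> is the set \<open>M\<close> indexed by \<open>(l, v, s)\<close>. These sets need not be disjoint, so
  composition and the action on algebras also take the indices as arguments:
  \<open>clone_comp M a b s f g\<close> composes \<open>f \<in> ops M a s\<close> with \<open>g i \<in> ops M b (snd a i)\<close>.
\<close>

record ('k, 's, 'f) clone =
  ops :: "('k, 's) arity \<Rightarrow> 's \<Rightarrow> 'f set"
  proj :: "('k, 's) arity \<Rightarrow> 'k \<Rightarrow> 'f"
  clone_comp :: "('k, 's) arity \<Rightarrow> ('k, 's) arity \<Rightarrow> 's \<Rightarrow> 'f \<Rightarrow> ('k \<Rightarrow> 'f) \<Rightarrow> 'f"

locale is_clone =
  fixes \<kappa> :: "'k rel" and M :: "('k, 's, 'f) clone"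
  assumes proj_closed:
      "\<lbrakk>a \<in> arity_set \<kappa>; i \<in> underS \<kappa> (fst a)\<rbrakk> \<Longrightarrow> proj M a i \<in> ops M a (snd a i)"
    and comp_closed:
      "\<lbrakk>a \<in> arity_set \<kappa>; b \<in> arity_set \<kappa>; f \<in> ops M a s; g \<in> tuples \<kappa> a (ops M b)\<rbrakk>
        \<Longrightarrow> clone_comp M a b s f g \<in> ops M b s"
    and comp_assoc:
      "\<lbrakk>a \<in> arity_set \<kappa>; b \<in> arity_set \<kappa>; c \<in> arity_set \<kappa>;
        f \<in> ops M a s; g \<in> tuples \<kappa> a (ops M b); h \<in> tuples \<kappa> b (ops M c)\<rbrakk>
        \<Longrightarrow> clone_comp M b c s (clone_comp M a b s f g) h =
            clone_comp M a c s f (\<lambda>i\<in>underS \<kappa> (fst a). clone_comp M b c (snd a i) (g i) h)"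
    and proj_comp:
      "\<lbrakk>a \<in> arity_set \<kappa>; b \<in> arity_set \<kappa>; i \<in> underS \<kappa> (fst a); g \<in> tuples \<kappa> a (ops M b)\<rbrakk>
        \<Longrightarrow> clone_comp M a b (snd a i) (proj M a i) g = g i"
    and comp_proj:
      "\<lbrakk>a \<in> arity_set \<kappa>; f \<in> ops M a s\<rbrakk>
        \<Longrightarrow> clone_comp M a a s f (\<lambda>i\<in>underS \<kappa> (fst a). proj M a i) = f"

definition pure :: "'k rel \<Rightarrow> ('k, 's, 'f) clone \<Rightarrow> bool" where
  "pure \<kappa> M \<longleftrightarrow> (\<forall>s1 s2. \<forall>(l, v)\<in>arity_set \<kappa>.
     card (underS \<kappa> l) = 1 \<and> (\<forall>i\<in>underS \<kappa> l. v i = s1) \<longrightarrow> ops M (l, v) s2 \<noteq> {})"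

record ('k, 's, 'f, 'a) algebra =
  car :: "'s \<Rightarrow> 'a set"
  act :: "('k, 's) arity \<Rightarrow> 's \<Rightarrow> 'f \<Rightarrow> ('k \<Rightarrow> 'a) \<Rightarrow> 'a"

locale is_algebra =
  fixes \<kappa> :: "'k rel" and M :: "('k, 's, 'f) clone" and A :: "('k, 's, 'f, 'a) algebra"
  assumes act_closed:
      "\<lbrakk>a \<in> arity_set \<kappa>; f \<in> ops M a s; x \<in> tuples \<kappa> a (car A)\<rbrakk> \<Longrightarrow> act A a s f x \<in> car A s"
    and act_proj:
      "\<lbrakk>a \<in> arity_set \<kappa>; i \<in> underS \<kappa> (fst a); x \<in> tuples \<kappa> a (car A)\<rbrakk>
        \<Longrightarrow> act A a (snd a i) (proj M a i) x = x i"
    and act_comp: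
      "\<lbrakk>a \<in> arity_set \<kappa>; b \<in> arity_set \<kappa>;
        f \<in> ops M a s; g \<in> tuples \<kappa> a (ops M b); x \<in> tuples \<kappa> b (car A)\<rbrakk>
        \<Longrightarrow> act A b s (clone_comp M a b s f g) x =
            act A a s f (\<lambda>i\<in>underS \<kappa> (fst a). act A b (snd a i) (g i) x)"

definition is_hom :: "'k rel \<Rightarrow> ('k, 's, 'f) clone \<Rightarrow> ('k, 's, 'f, 'a) algebra \<Rightarrow>
    ('k, 's, 'f, 'b) algebra \<Rightarrow> ('s \<Rightarrow> 'a \<Rightarrow> 'b) \<Rightarrow> bool" where
  "is_hom \<kappa> M A B h \<longleftrightarrow>
     (\<forall>s. h s \<in> car A s \<rightarrow> car B s) \<and>
     (\<forall>a\<in>arity_set \<kappa>. \<forall>s. \<forall>f\<in>ops M a s. \<forall>x\<in>tuples \<kappa> a (car A).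
        h s (act A a s f x) = act B a s f (\<lambda>i\<in>underS \<kappa> (fst a). h (snd a i) (x i)))"

definition isomorphic :: "'k rel \<Rightarrow> ('k, 's, 'f) clone \<Rightarrow> ('k, 's, 'f, 'a) algebra \<Rightarrow>
    ('k, 's, 'f, 'b) algebra \<Rightarrow> bool" where
  "isomorphic \<kappa> M A B \<longleftrightarrow> (\<exists>h. is_hom \<kappa> M A B h \<and> (\<forall>s. bij_betw (h s) (car A s) (car B s)))"

definition is_subalgebra :: "'k rel \<Rightarrow> ('k, 's, 'f) clone \<Rightarrow> ('k, 's, 'f, 'a) algebra \<Rightarrow>
    ('s \<Rightarrow> 'a set) \<Rightarrow> bool" where
  "is_subalgebra \<kappa> M A C \<longleftrightarrow>
     (\<forall>s. C s \<subseteq> car A s) \<and>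
     (\<forall>a\<in>arity_set \<kappa>. \<forall>s. \<forall>f\<in>ops M a s. \<forall>x\<in>tuples \<kappa> a C. act A a s f x \<in> C s)"

definition product_algebra :: "'k rel \<Rightarrow> 'i set \<Rightarrow> ('i \<Rightarrow> ('k, 's, 'f, 'u) algebra) \<Rightarrow>
    ('k, 's, 'f, 'i \<Rightarrow> 'u) algebra" where
  "product_algebra \<kappa> I B =
     \<lparr>car = (\<lambda>s. \<Pi>\<^sub>E j\<in>I. car (B j) s),
      act = (\<lambda>a s f x. \<lambda>j\<in>I. act (B j) a s f (\<lambda>i\<in>underS \<kappa> (fst a). x i j))\<rparr>"

definition H_closure :: "'k rel \<Rightarrow> ('k, 's, 'f) clone \<Rightarrow> ('k, 's, 'f, 'b) algebra set \<Rightarrow>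
    ('k, 's, 'f, 'a) algebra set" where
  "H_closure \<kappa> M X = {A. is_algebra \<kappa> M A \<and>
     (\<exists>B\<in>X. \<exists>h. is_hom \<kappa> M B A h \<and> (\<forall>s. h s ` car B s = car A s))}"

definition S_closure :: "'k rel \<Rightarrow> ('k, 's, 'f) clone \<Rightarrow> ('k, 's, 'f, 'b) algebra set \<Rightarrow>
    ('k, 's, 'f, 'a) algebra set" where
  "S_closure \<kappa> M X = {A. is_algebra \<kappa> M A \<and>
     (\<exists>B\<in>X. \<exists>C. is_subalgebra \<kappa> M B C \<and> isomorphic \<kappa> M A (B\<lparr>car := C\<rparr>))}"

text \<open>Products over all index sets (including the empty one) drawn from the type \<open>'i\<close>.\<close>

definition P_closure :: "'k rel \<Rightarrow> ('k, 's, 'f) clone \<Rightarrow> 'i itself \<Rightarrow>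
    ('k, 's, 'f, 'u) algebra set \<Rightarrow> ('k, 's, 'f, 'a) algebra set" where
  "P_closure \<kappa> M _ X = {A. is_algebra \<kappa> M A \<and>
     (\<exists>(I :: 'i set) B. (\<forall>j\<in>I. B j \<in> X) \<and> isomorphic \<kappa> M A (product_algebra \<kappa> I B))}"

text \<open>
  The closure operators are polymorphic in the carrier type of their result. Intermediate algebras
  are taken on \<open>'i \<Rightarrow> 'u\<close>, which carries every product indexed by a subset of \<open>'i\<close> and every
  subalgebra of such a product.
\<close>

definition HSP :: "'k rel \<Rightarrow> ('k, 's, 'f) clone \<Rightarrow> 'i itself \<Rightarrow>
    ('k, 's, 'f, 'u) algebra set \<Rightarrow> ('k, 's, 'f, 'a) algebra set" where
  "HSP \<kappa> M t K = H_closure \<kappa> M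
     (S_closure \<kappa> M (P_closure \<kappa> M t K :: ('k, 's, 'f, 'i \<Rightarrow> 'u) algebra set)
       :: ('k, 's, 'f, 'i \<Rightarrow> 'u) algebra set)"

text \<open>The identity \<open>f = g\<close> between operations of index \<open>(a, s)\<close> holds in \<open>A\<close>.\<close>

definition satisfies :: "'k rel \<Rightarrow> ('k, 's, 'f, 'a) algebra \<Rightarrow> ('k, 's) arity \<Rightarrow> 's \<Rightarrow>
    'f \<Rightarrow> 'f \<Rightarrow> bool" where
  "satisfies \<kappa> A a s f g \<longleftrightarrow> (\<forall>x\<in>tuples \<kappa> a (car A). act A a s f x = act A a s g x)"

definition variety :: "'k rel \<Rightarrow> ('k, 's, 'f) clone \<Rightarrow> ('k, 's, 'f, 'u) algebra set \<Rightarrow>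
    ('k, 's, 'f, 'a) algebra set" where
  "variety \<kappa> M K = {A. is_algebra \<kappa> M A \<and>
     (\<forall>a\<in>arity_set \<kappa>. \<forall>s. \<forall>f\<in>ops M a s. \<forall>g\<in>ops M a s.
        (\<forall>B\<in>K. satisfies \<kappa> B a s f g) \<longrightarrow> satisfies \<kappa> A a s f g)}"

text \<open>
  HOL cannot quantify over all index sets of products at once. For \<open>K\<close> on carrier type \<open>'u\<close> and
  target algebras on \<open>'a\<close>, this type has room for all pairs of an algebra in \<open>K\<close> and a valuation
  of the elements of the target algebra in it.
\<close>

type_synonym ('k, 's, 'f, 'u, 'a) valuation_index = "('k, 's, 'f, 'u) algebra \<times> ('s \<Rightarrow> 'a \<Rightarrow> 'u)"

end

theory Submission
  imports Defs
begin

text \<open>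
  For \<open>A\<close> in the variety, take the product of all pairs \<open>(B, w)\<close> of an algebra \<open>B \<in> K\<close> and a valuation
  \<open>w\<close> of \<open>A\<close> in \<open>B\<close>. Each element of \<open>A\<close> gives the tuple of its values under all \<open>w\<close>, and the
  subalgebra generated by these tuples maps onto \<open>A\<close> by sending a generator back to its element.
  This is well defined: two expressions with the same value in the product can be written over a
  common injective list of fewer than \<open>\<kappa>\<close> variables; by purity every assignment of these variables
  in \<open>B \<in> K\<close> extends to a valuation of \<open>A\<close>, so the two expressions form an identity of \<open>K\<close>, which
  holds in \<open>A\<close>.
\<close>

section \<open>Tuples, their images under sorted maps, and the variables occurring in them\<close>

abbreviation map_tuple :: "'k rel \<Rightarrow> ('k, 's) arity \<Rightarrow> ('s \<Rightarrow> 'a \<Rightarrow> 'b) \<Rightarrow> ('k \<Rightarrow> 'a) \<Rightarrow> 'k \<Rightarrow> 'b" where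
  "map_tuple \<kappa> a w y \<equiv> \<lambda>i\<in>underS \<kappa> (fst a). w (snd a i) (y i)"

text \<open>Elements are paired with their sorts because carriers of different sorts may overlap:
  one element counts as a separate variable in each sort.\<close>

definition support :: "'k rel \<Rightarrow> ('k, 's) arity \<Rightarrow> ('k \<Rightarrow> 'a) \<Rightarrow> ('s \<times> 'a) set" where
  "support \<kappa> a y = (\<lambda>i. (snd a i, y i)) ` underS \<kappa> (fst a)"

lemma tuples_nth: "\<lbrakk>x \<in> tuples \<kappa> a X; i \<in> underS \<kappa> (fst a)\<rbrakk> \<Longrightarrow> x i \<in> X (snd a i)"
  by (auto simp: tuples_def)

lemma tuples_restrict:
  "(\<And>i. i \<in> underS \<kappa> (fst a) \<Longrightarrow> x i \<in> X (snd a i)) \<Longrightarrow> restrict x (underS \<kappa> (fst a)) \<in> tuples \<kappa> a X"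
  by (auto simp: tuples_def)

lemma tuples_ext:
  "\<lbrakk>x \<in> tuples \<kappa> a X; y \<in> tuples \<kappa> a Y; \<And>i. i \<in> underS \<kappa> (fst a) \<Longrightarrow> x i = y i\<rbrakk> \<Longrightarrow> x = y"
  unfolding tuples_def by (rule extensionalityI) (auto simp: PiE_def)

lemma restrict_tuples: "x \<in> tuples \<kappa> a X \<Longrightarrow> restrict x (underS \<kappa> (fst a)) = x"
  by (simp add: tuples_def PiE_restrict)

lemma tuples_mono: "(\<And>s. X s \<subseteq> Y s) \<Longrightarrow> tuples \<kappa> a X \<subseteq> tuples \<kappa> a Y"
  unfolding tuples_def by (rule PiE_mono)

lemma map_tuple_tuples:
  "\<lbrakk>x \<in> tuples \<kappa> a X; \<And>s. w s \<in> X s \<rightarrow> Y s\<rbrakk> \<Longrightarrow> map_tuple \<kappa> a w x \<in> tuples \<kappa> a Y"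
  by (rule tuples_restrict) (use tuples_nth in fastforce)

lemma support_subset: "x \<in> tuples \<kappa> a X \<Longrightarrow> support \<kappa> a x \<subseteq> Sigma UNIV X"
  unfolding support_def using tuples_nth by fastforce


section \<open>Identities are preserved by H, S and P\<close>

text \<open>Every tuple of \<open>A\<close> lifts coordinatewise to a tuple of \<open>B\<close>,
  where the identity holds, and \<open>h\<close> carries the equality back to
  \<open>A\<close>.\<close>

lemma satisfies_surjective_hom:
  assumes hom: "is_hom \<kappa> M B A h" and surj: "\<And>s. h s ` car B s = car A s"
    and a: "a \<in> arity_set \<kappa>" and f: "f \<in> ops M a s" and g: "g \<in> ops M a s"
    and B: "satisfies \<kappa> B a s f g"
  shows "satisfies \<kappa> A a s f g"
  unfolding satisfies_def
proof
  fix x assume x: "x \<in> tuples \<kappa> a (car A)"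
  define y where "y = map_tuple \<kappa> a (\<lambda>s. inv_into (car B s) (h s)) x"
  have y: "y \<in> tuples \<kappa> a (car B)"
    unfolding y_def by (rule map_tuple_tuples[OF x]) (metis Pi_I inv_into_into surj)
  have "x = map_tuple \<kappa> a h y"
    by (rule tuples_ext[OF x map_tuple_tuples[OF y]])
      (use hom tuples_nth[OF x] surj in \<open>auto simp: is_hom_def y_def f_inv_into_f\<close>)
  then have "act A a s f x = h s (act B a s f y)" "act A a s g x = h s (act B a s g y)"
    using hom a f g y by (simp_all add: is_hom_def)
  then show "act A a s f x = act A a s g x"
    using B y by (simp add: satisfies_def)
qed

text \<open>The images under \<open>h\<close> of the two values agree by the identity in
  \<open>B\<close>. Both values lie in the carrier of \<open>A\<close>, so injectivity there cancels
  \<open>h\<close>. This serves for the isomorphisms hidden in S and P.\<close>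

lemma satisfies_injective_hom:
  assumes hom: "is_hom \<kappa> M A B h" and inj: "\<And>s. inj_on (h s) (car A s)"
    and A: "is_algebra \<kappa> M A"
    and a: "a \<in> arity_set \<kappa>" and f: "f \<in> ops M a s" and g: "g \<in> ops M a s"
    and B: "satisfies \<kappa> B a s f g"
  shows "satisfies \<kappa> A a s f g"
  unfolding satisfies_def
proof
  fix x assume x: "x \<in> tuples \<kappa> a (car A)"
  have "map_tuple \<kappa> a h x \<in> tuples \<kappa> a (car B)"
    by (rule map_tuple_tuples[OF x]) (use hom in \<open>simp add: is_hom_def\<close>)
  then have "h s (act A a s f x) = h s (act A a s g x)"
    using hom a f g x B by (simp add: is_hom_def satisfies_def)
  then show "act A a s f x = act A a s g x"
    using inj_onD[OF inj] is_algebra.act_closed[OF A a _ x] f g by blast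
qed

lemma satisfies_subset:
  "\<lbrakk>satisfies \<kappa> B a s f g; \<And>s. C s \<subseteq> car B s\<rbrakk> \<Longrightarrow> satisfies \<kappa> (B\<lparr>car := C\<rparr>) a s f g"
  using tuples_mono[of C "car B"] by (fastforce simp: satisfies_def)

lemma satisfies_product:
  assumes "\<And>j. j \<in> I \<Longrightarrow> satisfies \<kappa> (B j) a s f g"
  shows "satisfies \<kappa> (product_algebra \<kappa> I B) a s f g"
  unfolding satisfies_def
proof
  fix x assume x: "x \<in> tuples \<kappa> a (car (product_algebra \<kappa> I B))"
  have "(\<lambda>i\<in>underS \<kappa> (fst a). x i j) \<in> tuples \<kappa> a (car (B j))" if "j \<in> I" for j
    by (rule tuples_restrict) (use tuples_nth[OF x] that in \<open>auto simp: product_algebra_def\<close>)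
  then show "act (product_algebra \<kappa> I B) a s f x = act (product_algebra \<kappa> I B) a s g x"
    using assms by (auto simp: product_algebra_def satisfies_def intro!: restrict_ext)
qed

lemma HSP_subset_variety:
  fixes K :: "('k, 's, 'f, 'u) algebra set" and t :: "'i itself"
  shows "HSP \<kappa> M t K \<subseteq> variety \<kappa> M K"
proof
  fix A assume "A \<in> HSP \<kappa> M t K"
  then obtain B :: "('k, 's, 'f, 'i \<Rightarrow> 'u) algebra" and h where A: "is_algebra \<kappa> M A"
    and B: "B \<in> S_closure \<kappa> M (P_closure \<kappa> M t K :: ('k, 's, 'f, 'i \<Rightarrow> 'u) algebra set)"
    and h: "is_hom \<kappa> M B A h" "\<And>s. h s ` car B s = car A s"
    by (auto simp: HSP_def H_closure_def)
  from B obtain D :: "('k, 's, 'f, 'i \<Rightarrow> 'u) algebra" and C h' where algB: "is_algebra \<kappa> M B" and D: "D \<in> P_closure \<kappa> M t K"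
    and C: "is_subalgebra \<kappa> M D C" and h': "is_hom \<kappa> M B (D\<lparr>car := C\<rparr>) h'"
      "\<And>s. bij_betw (h' s) (car B s) (C s)"
    by (auto simp: S_closure_def isomorphic_def)
  from D obtain I :: "'i set" and E h'' where algD: "is_algebra \<kappa> M D" and E: "\<And>j. j \<in> I \<Longrightarrow> E j \<in> K"
    and h'': "is_hom \<kappa> M D (product_algebra \<kappa> I E) h''"
      "\<And>s. bij_betw (h'' s) (car D s) (car (product_algebra \<kappa> I E) s)"
    by (auto simp: P_closure_def isomorphic_def)
  \<comment> \<open>The identity is followed outwards through the construction of \<open>A\<close>:
    product, isomorphic copy, subalgebra, isomorphic copy, homomorphic image.\<close>
  have "satisfies \<kappa> A a s f g"
    if a: "a \<in> arity_set \<kappa>" and fg: "f \<in> ops M a s" "g \<in> ops M a s"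
      and K: "\<forall>B\<in>K. satisfies \<kappa> B a s f g" for a s f g
  proof -
    have "satisfies \<kappa> (product_algebra \<kappa> I E) a s f g"
      using E K by (intro satisfies_product) auto
    then have "satisfies \<kappa> D a s f g"
      by (rule satisfies_injective_hom[OF h''(1) bij_betw_imp_inj_on[OF h''(2)] algD a fg])
    then have "satisfies \<kappa> (D\<lparr>car := C\<rparr>) a s f g"
      by (rule satisfies_subset) (use C in \<open>simp add: is_subalgebra_def\<close>)
    then have "satisfies \<kappa> B a s f g"
      by (rule satisfies_injective_hom[OF h'(1) bij_betw_imp_inj_on[OF h'(2)] algB a fg])
    then show ?thesis
      by (rule satisfies_surjective_hom[OF h a fg])
  qed
  with A show "A \<in> variety \<kappa> M K"
    by (simp add: variety_def)
qed


section \<open>Algebras and arities\<close>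

lemma isomorphic_refl: "is_algebra \<kappa> M A \<Longrightarrow> isomorphic \<kappa> M A A"
  unfolding isomorphic_def is_hom_def
  by (rule exI[of _ "\<lambda>s x. x"]) (auto simp: restrict_tuples bij_betw_def)

lemma is_algebra_subalgebra:
  assumes A: "is_algebra \<kappa> M A" and C: "is_subalgebra \<kappa> M A C"
  shows "is_algebra \<kappa> M (A\<lparr>car := C\<rparr>)"
proof -
  interpret is_algebra \<kappa> M A by fact
  have "tuples \<kappa> a C \<subseteq> tuples \<kappa> a (car A)" for a
    using C by (intro tuples_mono) (simp add: is_subalgebra_def)
  then show ?thesis
    using C by unfold_locales (auto simp: is_subalgebra_def act_proj act_comp subset_iff)
qed

lemma is_algebra_product:
  assumes B: "\<And>j. j \<in> I \<Longrightarrow> is_algebra \<kappa> M (B j)"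
  shows "is_algebra \<kappa> M (product_algebra \<kappa> I B)"
proof -
  let ?P = "product_algebra \<kappa> I B"
  \<comment> \<open>The \<open>j\<close>-th coordinates of a tuple in the product form a tuple of
    \<open>B j\<close>, so each law can be checked in one factor at a time.\<close>
  have component: "(\<lambda>i\<in>underS \<kappa> (fst a). x i j) \<in> tuples \<kappa> a (car (B j))"
    if x: "x \<in> tuples \<kappa> a (car ?P)" and j: "j \<in> I" for a x j
    by (rule tuples_restrict) (use tuples_nth[OF x] j in \<open>auto simp: product_algebra_def\<close>)
  show ?thesis
  proof
    fix a f s x assume "a \<in> arity_set \<kappa>" "f \<in> ops M a s" "x \<in> tuples \<kappa> a (car ?P)"
    then show "act ?P a s f x \<in> car ?P s"
      using component is_algebra.act_closed[OF B] by (auto simp: product_algebra_def)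
  next
    fix a i x assume a: "a \<in> arity_set \<kappa>" and i: "i \<in> underS \<kappa> (fst a)"
      and x: "x \<in> tuples \<kappa> a (car ?P)"
    have "x i \<in> (\<Pi>\<^sub>E j\<in>I. car (B j) (snd a i))"
      using tuples_nth[OF x i] by (simp add: product_algebra_def)
    then show "act ?P a (snd a i) (proj M a i) x = x i"
      using is_algebra.act_proj[OF B a i component[OF x]] i
      by (intro extensionalityI[of _ I]) (auto simp: product_algebra_def PiE_def)
  next
    fix a b f s g x
    assume a: "a \<in> arity_set \<kappa>" and b: "b \<in> arity_set \<kappa>" and f: "f \<in> ops M a s"
      and g: "g \<in> tuples \<kappa> a (ops M b)" and x: "x \<in> tuples \<kappa> b (car ?P)"
    show "act ?P b s (clone_comp M a b s f g) x =
      act ?P a s f (\<lambda>i\<in>underS \<kappa> (fst a). act ?P b (snd a i) (g i) x)"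
      using is_algebra.act_comp[OF B a b f g component[OF x]]
      by (auto simp: product_algebra_def intro!: restrict_ext cong: restrict_cong)
  qed
qed

section \<open>Arities and sets of fewer than \<kappa> variables\<close>

lemma card_of_underS_arity:
  "\<lbrakk>Card_order \<kappa>; a \<in> arity_set \<kappa>\<rbrakk> \<Longrightarrow> |underS \<kappa> (fst a)| <o \<kappa>"
  by (auto simp: arity_set_def cardinals_below_def intro: card_of_underS)

lemma card_of_support:
  "\<lbrakk>Card_order \<kappa>; a \<in> arity_set \<kappa>\<rbrakk> \<Longrightarrow> |support \<kappa> a y| <o \<kappa>"
  unfolding support_def by (rule ordLeq_ordLess_trans[OF card_of_image card_of_underS_arity])

text \<open>The cardinal of \<open>Y\<close> is order isomorphic to a proper initial segment of
  \<kappa>. Being a cardinal order is invariant under isomorphism, so the segment is cut off by an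
  initial ordinal.\<close>

lemma cardinals_below_exists:
  assumes \<kappa>: "Card_order \<kappa>" and Y: "|Y| <o \<kappa>"
  obtains l e where "l \<in> cardinals_below \<kappa>" "bij_betw e (underS \<kappa> l) Y"
proof -
  have wo: "Well_order \<kappa>"
    using \<kappa> by (simp add: card_order_on_def)
  obtain l where l: "l \<in> Field \<kappa>" and iso: "|Y| =o Restr \<kappa> (underS \<kappa> l)"
    using ordLess_iff_ordIso_Restr[OF wo card_of_Well_order] Y by blast
  have card: "Card_order (Restr \<kappa> (underS \<kappa> l))"
    by (rule Card_order_ordIso2[OF card_of_Card_order iso])
  have "Field (Restr \<kappa> (underS \<kappa> l)) = underS \<kappa> l"
    using wo by (intro Field_Restr_ofilter) (simp_all add: wo_rel_def wo_rel.underS_ofilter)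
  then have "|underS \<kappa> l| =o |Y|"
    using card_of_Field_ordIso[OF card] ordIso_transitive ordIso_symmetric[OF iso] by metis
  then obtain e where "bij_betw e (underS \<kappa> l) Y"
    using card_of_ordIso by blast
  with l card show thesis
    by (intro that) (simp_all add: cardinals_below_def)
qed

text \<open>A bijection \<open>e\<close> from an initial ordinal onto \<open>Y\<close> is split in
  two: its first components are the sorts of the arity, its second components the listed elements.
  Injectivity of \<open>e\<close> means that no variable is listed twice.\<close>

lemma arity_enumerating:
  assumes "Card_order \<kappa>" "|Y| <o \<kappa>" and Y: "Y \<subseteq> Sigma UNIV X"
  obtains c z where "c \<in> arity_set \<kappa>" "z \<in> tuples \<kappa> c X" "support \<kappa> c z = Y"
    "inj_on (\<lambda>i. (snd c i, z i)) (underS \<kappa> (fst c))"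
proof -
  obtain l e where l: "l \<in> cardinals_below \<kappa>" and e: "bij_betw e (underS \<kappa> l) Y"
    using cardinals_below_exists assms by metis
  define c where "c = (l, \<lambda>i\<in>underS \<kappa> l. fst (e i))"
  define z where "z = (\<lambda>i\<in>underS \<kappa> l. snd (e i))"
  have eY: "e i \<in> Y" if "i \<in> underS \<kappa> l" for i
    using e that by (auto simp: bij_betw_def)
  have e_eq: "(snd c i, z i) = e i" if "i \<in> underS \<kappa> l" for i
    using that by (simp add: c_def z_def)
  show thesis
  proof
    show "c \<in> arity_set \<kappa>"
      using l by (auto simp: c_def arity_set_def)
    show "z \<in> tuples \<kappa> c X"
      using eY Y by (fastforce simp: c_def z_def tuples_def)
    have fst_c: "fst c = l"
      by (simp add: c_def)
    show "support \<kappa> c z = Y"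
      using e e_eq unfolding support_def fst_c bij_betw_def by (metis (mono_tags, lifting) image_cong)
    show "inj_on (\<lambda>i. (snd c i, z i)) (underS \<kappa> (fst c))"
      using e e_eq unfolding fst_c bij_betw_def by (metis (mono_tags, lifting) inj_on_cong)
  qed
qed

lemma finite_ordLess_Cinfinite: "\<lbrakk>Cinfinite \<kappa>; finite Y\<rbrakk> \<Longrightarrow> |Y| <o \<kappa>"
  by (rule finite_ordLess_infinite)
    (auto simp: cinfinite_def card_of_well_order_on Field_card_of dest: card_order_on_well_order_on)

text \<open>Purity supplies a unary operation from sort \<open>s1\<close> to sort \<open>s2\<close>;
  its value at \<open>p\<close> is the required element.\<close>

lemma pure_nonempty_carrier:
  assumes \<kappa>: "Cinfinite \<kappa>" and pure: "pure \<kappa> M" and B: "is_algebra \<kappa> M B"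
    and p: "p \<in> car B s1"
  shows "car B s2 \<noteq> {}"
proof -
  \<comment> \<open>Enumerating a singleton yields a unary arity together with the tuple consisting
    of \<open>p\<close>, without naming the element of \<kappa> that represents the cardinal
    1.\<close>
  let ?Y = "{(s1, p)}"
  have "|?Y| <o \<kappa>"
    by (rule finite_ordLess_Cinfinite[OF \<kappa>]) simp
  then obtain c z where c: "c \<in> arity_set \<kappa>" "z \<in> tuples \<kappa> c (car B)" and z: "support \<kappa> c z = ?Y"
    "inj_on (\<lambda>i. (snd c i, z i)) (underS \<kappa> (fst c))"
    using arity_enumerating[of \<kappa> ?Y "car B"] \<kappa> p by auto
  have "card (underS \<kappa> (fst c)) = 1" "\<forall>i\<in>underS \<kappa> (fst c). snd c i = s1"
    using card_image[OF z(2)] z(1) by (auto simp: support_def)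
  then have "ops M c s2 \<noteq> {}"
    using pure[unfolded pure_def, rule_format, OF c(1), of s1 s2] by (simp add: case_prod_beta)
  then show ?thesis
    using is_algebra.act_closed[OF B c(1) _ c(2)] by blast
qed


section \<open>Change of variables\<close>

text \<open>Rewrites an operation on the variables \<open>y\<close> as one on a list \<open>z\<close> containing all of them.\<close>

definition reindex :: "'k rel \<Rightarrow> ('k, 's, 'f) clone \<Rightarrow> ('k, 's) arity \<Rightarrow> ('k \<Rightarrow> 'a) \<Rightarrow>
    ('k, 's) arity \<Rightarrow> ('k \<Rightarrow> 'a) \<Rightarrow> 's \<Rightarrow> 'f \<Rightarrow> 'f" where
  "reindex \<kappa> M a y c z s f = clone_comp M a c s f (\<lambda>i\<in>underS \<kappa> (fst a).
     proj M c (inv_into (underS \<kappa> (fst c)) (\<lambda>j. (snd c j, z j)) (snd a i, y i)))"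

context
  fixes \<kappa> :: "'k rel" and M :: "('k, 's, 'f) clone" and a c y z s f
  assumes clone: "is_clone \<kappa> M"
    and a: "a \<in> arity_set \<kappa>" and c: "c \<in> arity_set \<kappa>" and f: "f \<in> ops M a s"
    and sub: "support \<kappa> a y \<subseteq> support \<kappa> c z"
begin

private definition "index i = inv_into (underS \<kappa> (fst c)) (\<lambda>j. (snd c j, z j)) (snd a i, y i)"

text \<open>The variable at position \<open>i\<close> of \<open>y\<close> occurs in \<open>z\<close>
  with the same sort, so a position can be chosen. If \<open>z\<close> repeats it, any choice will
  do.\<close>

private lemma index:
  assumes "i \<in> underS \<kappa> (fst a)"
  shows "index i \<in> underS \<kappa> (fst c)" "snd c (index i) = snd a i" "z (index i) = y i"
proof -
  have "(snd a i, y i) \<in> (\<lambda>j. (snd c j, z j)) ` underS \<kappa> (fst c)"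
    using sub assms by (auto simp: support_def)
  from inv_into_into[OF this] f_inv_into_f[OF this]
  show "index i \<in> underS \<kappa> (fst c)" "snd c (index i) = snd a i" "z (index i) = y i"
    by (auto simp: index_def)
qed

private lemma proj_index: "(\<lambda>i\<in>underS \<kappa> (fst a). proj M c (index i)) \<in> tuples \<kappa> a (ops M c)"
  by (rule tuples_restrict) (metis index(1,2) is_clone.proj_closed[OF clone c])

lemma reindex_closed: "reindex \<kappa> M a y c z s f \<in> ops M c s"
  using is_clone.comp_closed[OF clone a c f proj_index] by (simp add: reindex_def index_def)

text \<open>The projections first select from the values of \<open>z\<close> those of
  \<open>y\<close>, to which \<open>f\<close> is then applied. As \<open>w\<close> is arbitrary,
  this covers valuations in members of \<open>K\<close> as well as the identity on
  \<open>A\<close>.\<close>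

lemma act_reindex:
  assumes B: "is_algebra \<kappa> M B" and wz: "map_tuple \<kappa> c w z \<in> tuples \<kappa> c (car B)"
  shows "act B c s (reindex \<kappa> M a y c z s f) (map_tuple \<kappa> c w z) = act B a s f (map_tuple \<kappa> a w y)"
proof -
  have "act B c (snd a i) (proj M c (index i)) (map_tuple \<kappa> c w z) = w (snd a i) (y i)"
    if i: "i \<in> underS \<kappa> (fst a)" for i
    using is_algebra.act_proj[OF B c index(1)[OF i] wz] index[OF i] by simp
  then show ?thesis
    using is_algebra.act_comp[OF B a c f proj_index wz]
    by (simp add: reindex_def index_def cong: restrict_cong)
qed

end


section \<open>The relatively free algebra over an algebra of the variety\<close>

locale variety_member = is_clone \<kappa> M + A: is_algebra \<kappa> M A
  for \<kappa> :: "'k rel" and M :: "('k, 's, 'f) clone" and A :: "('k, 's, 'f, 'a) algebra" +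
  fixes K :: "('k, 's, 'f, 'u) algebra set"
  assumes Cinf: "Cinfinite \<kappa>" and regular: "regularCard \<kappa>" and pure: "pure \<kappa> M"
    and K: "\<And>B. B \<in> K \<Longrightarrow> is_algebra \<kappa> M B"
    and A_in_variety: "A \<in> variety \<kappa> M K"
begin

lemmas Card = conjunct2[OF Cinf]

lemma clone: "is_clone \<kappa> M" ..

lemma algebra_A: "is_algebra \<kappa> M A" ..

definition valuations :: "('k, 's, 'f, 'u, 'a) valuation_index set" where
  "valuations = {(B, w). B \<in> K \<and> (\<forall>s. w s \<in> car A s \<rightarrow> car B s)}"

text \<open>The term \<open>f\<close> in the variables \<open>y\<close>, read as an element of the
  power: its coordinate at \<open>(B, w)\<close> is its value in \<open>B\<close> under
  \<open>w\<close>. At a projection it is one of the generators.\<close>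

definition eval :: "('k, 's) arity \<Rightarrow> 's \<Rightarrow> 'f \<Rightarrow> ('k \<Rightarrow> 'a) \<Rightarrow>
    ('k, 's, 'f, 'u, 'a) valuation_index \<Rightarrow> 'u" where
  "eval a s f y = (\<lambda>(B, w)\<in>valuations. act B a s f (map_tuple \<kappa> a w y))"

definition free_power :: "('k, 's, 'f, ('k, 's, 'f, 'u, 'a) valuation_index \<Rightarrow> 'u) algebra" where
  "free_power = product_algebra \<kappa> valuations fst"

text \<open>One layer of operations applied to the generators is already the generated subalgebra,
  so no inductive closure is taken; see \<open>free_car_tuple\<close> and
  \<open>act_free_power\<close>.\<close>

definition free_car :: "'s \<Rightarrow> (('k, 's, 'f, 'u, 'a) valuation_index \<Rightarrow> 'u) set" where
  "free_car s = {eval a s f y |a f y. a \<in> arity_set \<kappa> \<and> f \<in> ops M a s \<and> y \<in> tuples \<kappa> a (car A)}"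

text \<open>The choice ranges over all representations of \<open>p\<close>; that they all give the
  same \<open>q\<close> is the content of \<open>eval_eq_imp_act_eq\<close>.\<close>

definition free_map :: "'s \<Rightarrow> (('k, 's, 'f, 'u, 'a) valuation_index \<Rightarrow> 'u) \<Rightarrow> 'a" where
  "free_map s p = (SOME q. \<exists>a f y. a \<in> arity_set \<kappa> \<and> f \<in> ops M a s \<and> y \<in> tuples \<kappa> a (car A) \<and>
     p = eval a s f y \<and> q = act A a s f y)"

lemma valuation_tuples:
  "\<lbrakk>(B, w) \<in> valuations; y \<in> tuples \<kappa> a (car A)\<rbrakk> \<Longrightarrow> map_tuple \<kappa> a w y \<in> tuples \<kappa> a (car B)"
  by (rule map_tuple_tuples) (auto simp: valuations_def)

lemma valuation_algebra: "(B, w) \<in> valuations \<Longrightarrow> is_algebra \<kappa> M B"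
  using K by (simp add: valuations_def)

lemma eval_in_power:
  "\<lbrakk>a \<in> arity_set \<kappa>; f \<in> ops M a s; y \<in> tuples \<kappa> a (car A)\<rbrakk> \<Longrightarrow> eval a s f y \<in> car free_power s"
  unfolding free_power_def product_algebra_def eval_def
  by (auto intro!: is_algebra.act_closed valuation_algebra valuation_tuples)

lemma eval_reindex:
  assumes "a \<in> arity_set \<kappa>" "c \<in> arity_set \<kappa>" "f \<in> ops M a s"
    and "support \<kappa> a y \<subseteq> support \<kappa> c z" "z \<in> tuples \<kappa> c (car A)"
  shows "eval c s (reindex \<kappa> M a y c z s f) z = eval a s f y"
  unfolding eval_def
  by (auto intro!: restrict_ext act_reindex[OF clone assms(1-4)]
      intro: valuation_algebra valuation_tuples[OF _ assms(5)])

lemma act_A_reindex: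
  assumes "a \<in> arity_set \<kappa>" "c \<in> arity_set \<kappa>" "f \<in> ops M a s"
    and "support \<kappa> a y \<subseteq> support \<kappa> c z" "z \<in> tuples \<kappa> c (car A)" "y \<in> tuples \<kappa> a (car A)"
  shows "act A c s (reindex \<kappa> M a y c z s f) z = act A a s f y"
  using act_reindex[OF clone assms(1-4) algebra_A, of "\<lambda>s x. x"] assms(5,6)
  by (simp add: restrict_tuples)

section \<open>Independence of \<open>free_map\<close> from the representation\<close>

text \<open>The variables \<open>z\<close> are distinct, so any tuple \<open>t\<close> of
  \<open>B\<close> is the image of \<open>z\<close> under some valuation \<open>w\<close>. Comparing
  the two equal elements at the coordinate \<open>(B, w)\<close> gives the identity at
  \<open>t\<close>.\<close>

lemma satisfies_if_eval_eq:
  assumes c: "c \<in> arity_set \<kappa>" and f: "f \<in> ops M c s"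
    and inj: "inj_on (\<lambda>i. (snd c i, z i)) (underS \<kappa> (fst c))"
    and eq: "eval c s f z = eval c s g z" and B: "B \<in> K"
  shows "satisfies \<kappa> B c s f g"
  unfolding satisfies_def
proof
  fix t assume t: "t \<in> tuples \<kappa> c (car B)"
  let ?e = "\<lambda>i. (snd c i, z i)"
  \<comment> \<open>A listed variable receives the entry of \<open>t\<close> at its position, which
    is unique by \<open>inj\<close>; every other element receives an arbitrary value of its
    sort.\<close>
  define w where "w s p = (if (s, p) \<in> support \<kappa> c z
    then t (inv_into (underS \<kappa> (fst c)) ?e (s, p)) else SOME q. q \<in> car B s)" for s p
  \<comment> \<open>A tuple \<open>t\<close> makes \<open>B\<close> nonempty in the sort \<open>s\<close> even if the arity \<open>c\<close> is zero, so by purity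
    \<open>t\<close> extends to a valuation of all of \<open>A\<close>.\<close>
  have "car B s' \<noteq> {}" for s'
    by (rule pure_nonempty_carrier[OF Cinf pure K[OF B]])
      (rule is_algebra.act_closed[OF K[OF B] c f t])
  moreover have w_nth: "w (snd c i) (z i) = t i" if "i \<in> underS \<kappa> (fst c)" for i
    using that inv_into_f_f[OF inj] by (auto simp: w_def support_def)
  ultimately have w_car: "w s' p \<in> car B s'" for s' p
  proof (cases "(s', p) \<in> support \<kappa> c z")
    case True
    then show ?thesis
      using w_nth tuples_nth[OF t] by (force simp: support_def)
  qed (simp add: w_def some_in_eq)
  have "(B, w) \<in> valuations"
    using B w_car by (simp add: valuations_def)
  moreover have "map_tuple \<kappa> c w z = t"
    by (rule tuples_ext[OF tuples_restrict t, of "\<lambda>i. w (snd c i) (z i)"]) (auto simp: w_nth w_car)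
  ultimately show "act B c s f t = act B c s g t"
    using fun_cong[OF eq, of "(B, w)"] by (simp add: eval_def)
qed

lemma eval_eq_imp_act_eq:
  assumes a: "a \<in> arity_set \<kappa>" "f \<in> ops M a s" "y \<in> tuples \<kappa> a (car A)"
    and b: "b \<in> arity_set \<kappa>" "g \<in> ops M b s" "y' \<in> tuples \<kappa> b (car A)"
    and eq: "eval a s f y = eval b s g y'"
  shows "act A a s f y = act A b s g y'"
proof -
  \<comment> \<open>A union of two sets smaller than the infinite cardinal \<kappa> is again
    smaller, so one list \<open>z\<close> can hold the variables of both terms.\<close>
  have "|support \<kappa> a y \<union> support \<kappa> b y'| <o \<kappa>"
    using Cinf a b by (intro card_of_Un_ordLess_infinite_Field card_of_support) (auto simp: cinfinite_def)
  then obtain c z where c: "c \<in> arity_set \<kappa>" and z: "z \<in> tuples \<kappa> c (car A)"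
    and supp: "support \<kappa> c z = support \<kappa> a y \<union> support \<kappa> b y'"
    and inj: "inj_on (\<lambda>i. (snd c i, z i)) (underS \<kappa> (fst c))"
    using arity_enumerating[OF Card _ Un_least[OF support_subset[OF a(3)] support_subset[OF b(3)]]]
    by blast
  have sub: "support \<kappa> a y \<subseteq> support \<kappa> c z" "support \<kappa> b y' \<subseteq> support \<kappa> c z"
    using supp by auto
  let ?f = "reindex \<kappa> M a y c z s f" and ?g = "reindex \<kappa> M b y' c z s g"
  have ops: "?f \<in> ops M c s" "?g \<in> ops M c s"
    using reindex_closed[OF clone] a b c sub by blast+
  have "eval c s ?f z = eval c s ?g z"
    using eval_reindex[OF a(1) c a(2) sub(1) z] eval_reindex[OF b(1) c b(2) sub(2) z] eq by simp
  then have "\<forall>B\<in>K. satisfies \<kappa> B c s ?f ?g"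
    using satisfies_if_eval_eq[OF c ops(1) inj] by blast
  then have "satisfies \<kappa> A c s ?f ?g"
    using A_in_variety c ops by (simp add: variety_def)
  then show ?thesis
    using act_A_reindex[OF a(1) c a(2) sub(1) z a(3)] act_A_reindex[OF b(1) c b(2) sub(2) z b(3)] z
    by (simp add: satisfies_def)
qed

lemma free_map_eval:
  assumes "a \<in> arity_set \<kappa>" "f \<in> ops M a s" "y \<in> tuples \<kappa> a (car A)"
  shows "free_map s (eval a s f y) = act A a s f y"
  unfolding free_map_def
  by (rule some_equality) (use assms in blast, metis assms eval_eq_imp_act_eq)

text \<open>Regularity of \<open>\<kappa>\<close> is what allows a tuple of values to be written over common variables.\<close>

lemma free_car_tuple:
  assumes a: "a \<in> arity_set \<kappa>" and x: "x \<in> tuples \<kappa> a free_car"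
  obtains c z g where "c \<in> arity_set \<kappa>" "z \<in> tuples \<kappa> c (car A)" "g \<in> tuples \<kappa> a (ops M c)"
    "\<And>i. i \<in> underS \<kappa> (fst a) \<Longrightarrow> x i = eval c (snd a i) (g i) z"
proof -
  have "\<forall>i\<in>underS \<kappa> (fst a). \<exists>b f y. b \<in> arity_set \<kappa> \<and> f \<in> ops M b (snd a i) \<and>
      y \<in> tuples \<kappa> b (car A) \<and> x i = eval b (snd a i) f y"
    using tuples_nth[OF x] by (fastforce simp: free_car_def)
  then obtain b f y where b: "\<And>i. i \<in> underS \<kappa> (fst a) \<Longrightarrow> b i \<in> arity_set \<kappa> \<and>
      f i \<in> ops M (b i) (snd a i) \<and> y i \<in> tuples \<kappa> (b i) (car A) \<and>
      x i = eval (b i) (snd a i) (f i) (y i)"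
    by metis
  let ?Y = "\<Union>i\<in>underS \<kappa> (fst a). support \<kappa> (b i) (y i)"
  \<comment> \<open>Fewer than \<kappa> supports, one for each position of \<open>a\<close>, are
    united, and each of them is smaller than \<kappa>.\<close>
  have "|?Y| <o \<kappa>"
    using Card a b by (intro regularCard_UNION_bound[OF Cinf regular])
      (auto intro: card_of_underS_arity card_of_support)
  moreover have "?Y \<subseteq> Sigma UNIV (car A)"
    using b support_subset by (intro UN_least) blast
  ultimately obtain c z where c: "c \<in> arity_set \<kappa>" "z \<in> tuples \<kappa> c (car A)" "support \<kappa> c z = ?Y"
    by (rule arity_enumerating[OF Card])
  have sub: "support \<kappa> (b i) (y i) \<subseteq> support \<kappa> c z" if "i \<in> underS \<kappa> (fst a)" for i
    using c(3) that by auto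
  let ?g = "\<lambda>i\<in>underS \<kappa> (fst a). reindex \<kappa> M (b i) (y i) c z (snd a i) (f i)"
  show thesis
  proof
    show "?g \<in> tuples \<kappa> a (ops M c)"
      by (rule tuples_restrict) (use reindex_closed[OF clone _ c(1)] b sub in blast)
    show "x i = eval c (snd a i) (?g i) z" if "i \<in> underS \<kappa> (fst a)" for i
      using eval_reindex[OF _ c(1) _ sub[OF that] c(2)] b[OF that] that by simp
  qed (use c in auto)
qed

text \<open>This is the composition law of each factor \<open>B\<close>, read at the coordinate
  \<open>(B, w)\<close>: an operation on terms over common variables is a single term over
  them.\<close>

lemma act_free_power:
  assumes a: "a \<in> arity_set \<kappa>" and c: "c \<in> arity_set \<kappa>" and f: "f \<in> ops M a s"
    and g: "g \<in> tuples \<kappa> a (ops M c)" and z: "z \<in> tuples \<kappa> c (car A)"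
    and x: "\<And>i. i \<in> underS \<kappa> (fst a) \<Longrightarrow> x i = eval c (snd a i) (g i) z"
  shows "act free_power a s f x = eval c s (clone_comp M a c s f g) z"
  using is_algebra.act_comp[OF valuation_algebra a c f g valuation_tuples[OF _ z]]
  by (auto simp: free_power_def product_algebra_def eval_def x intro!: restrict_ext
      cong: restrict_cong)

section \<open>The subalgebra of evaluations and its homomorphism onto \<open>A\<close>\<close>

lemma free_subalgebra: "is_subalgebra \<kappa> M free_power free_car"
  unfolding is_subalgebra_def
proof (intro conjI allI ballI)
  fix s show "free_car s \<subseteq> car free_power s"
    using eval_in_power by (auto simp: free_car_def)
next
  fix a s f x assume a: "a \<in> arity_set \<kappa>" and f: "f \<in> ops M a s" and x: "x \<in> tuples \<kappa> a free_car"
  from a x obtain c z g where *: "c \<in> arity_set \<kappa>" "z \<in> tuples \<kappa> c (car A)"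
    "g \<in> tuples \<kappa> a (ops M c)" "\<And>i. i \<in> underS \<kappa> (fst a) \<Longrightarrow> x i = eval c (snd a i) (g i) z"
    by (rule free_car_tuple) blast
  show "act free_power a s f x \<in> free_car s"
    using act_free_power[OF a *(1) f *(3,2,4)] comp_closed[OF a *(1) f *(3)] *(1,2)
    unfolding free_car_def by blast
qed

lemma free_map_hom: "is_hom \<kappa> M (free_power\<lparr>car := free_car\<rparr>) A free_map"
  unfolding is_hom_def
proof (intro conjI allI ballI)
  fix s show "free_map s \<in> car (free_power\<lparr>car := free_car\<rparr>) s \<rightarrow> car A s"
    by (auto simp: free_car_def free_map_eval A.act_closed)
next
  fix a s f x assume a: "a \<in> arity_set \<kappa>" and f: "f \<in> ops M a s"
    and "x \<in> tuples \<kappa> a (car (free_power\<lparr>car := free_car\<rparr>))"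
  then have x: "x \<in> tuples \<kappa> a free_car"
    by simp
  from a x obtain c z g where c: "c \<in> arity_set \<kappa>" and z: "z \<in> tuples \<kappa> c (car A)"
    and g: "g \<in> tuples \<kappa> a (ops M c)"
    and x_eq: "\<And>i. i \<in> underS \<kappa> (fst a) \<Longrightarrow> x i = eval c (snd a i) (g i) z"
    by (rule free_car_tuple) blast
  \<comment> \<open>Once all arguments are terms over the same \<open>z\<close>, the composition law
    in \<open>A\<close> mirrors the one in the power.\<close>
  have "map_tuple \<kappa> a free_map x = (\<lambda>i\<in>underS \<kappa> (fst a). act A c (snd a i) (g i) z)"
    using x_eq tuples_nth[OF g] free_map_eval[OF c _ z] by (auto intro!: restrict_ext)
  then show "free_map s (act (free_power\<lparr>car := free_car\<rparr>) a s f x) = act A a s f (map_tuple \<kappa> a free_map x)"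
    using act_free_power[OF a c f g z x_eq] free_map_eval[OF c comp_closed[OF a c f g] z]
      A.act_comp[OF a c f g z] by simp
qed

lemma free_map_surj: "free_map s ` free_car s = car A s"
proof
  show "free_map s ` free_car s \<subseteq> car A s"
    by (auto simp: free_car_def free_map_eval A.act_closed)
  show "car A s \<subseteq> free_map s ` free_car s"
  proof
    fix p assume p: "p \<in> car A s"
    \<comment> \<open>The preimage of \<open>p\<close> is the generator belonging to it: a
      projection evaluated at a list whose only variable is \<open>p\<close> in sort
      \<open>s\<close>.\<close>
    have "|{(s, p)}| <o \<kappa>"
      by (rule finite_ordLess_Cinfinite[OF Cinf]) simp
    then obtain c z where c: "c \<in> arity_set \<kappa>" "z \<in> tuples \<kappa> c (car A)" "support \<kappa> c z = {(s, p)}"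
      using arity_enumerating[OF Card, of "{(s, p)}" "car A"] p by blast
    then have "(s, p) \<in> support \<kappa> c z"
      by simp
    then obtain i where i: "i \<in> underS \<kappa> (fst c)" "snd c i = s" "z i = p"
      by (auto simp: support_def)
    have pr: "proj M c i \<in> ops M c s"
      using proj_closed[OF c(1) i(1)] i(2) by simp
    have "free_map s (eval c s (proj M c i) z) = p"
      using free_map_eval[OF c(1) pr c(2)] A.act_proj[OF c(1) i(1) c(2)] i by simp
    moreover have "eval c s (proj M c i) z \<in> free_car s"
      using c pr unfolding free_car_def by blast
    ultimately show "p \<in> free_map s ` free_car s"
      by force
  qed
qed

lemma in_HSP: "A \<in> HSP \<kappa> M TYPE(('k, 's, 'f, 'u, 'a) valuation_index) K"
proof -
  let ?P = "P_closure \<kappa> M TYPE(('k, 's, 'f, 'u, 'a) valuation_index) K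
    :: ('k, 's, 'f, ('k, 's, 'f, 'u, 'a) valuation_index \<Rightarrow> 'u) algebra set"
  let ?F = "free_power\<lparr>car := free_car\<rparr>"
  have index: "fst j \<in> K" if "j \<in> valuations" for j
    using that by (auto simp: valuations_def)
  have P: "is_algebra \<kappa> M free_power"
    unfolding free_power_def by (rule is_algebra_product[OF K[OF index]])
  have "isomorphic \<kappa> M free_power (product_algebra \<kappa> valuations fst)"
    using isomorphic_refl[OF P] by (simp only: free_power_def)
  then have "free_power \<in> ?P"
    using P index unfolding P_closure_def by blast
  moreover have F: "is_algebra \<kappa> M ?F"
    by (rule is_algebra_subalgebra[OF P free_subalgebra])
  ultimately have "?F \<in> S_closure \<kappa> M ?P"
    using isomorphic_refl[OF F] free_subalgebra unfolding S_closure_def by blast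
  moreover have "\<forall>s. free_map s ` car ?F s = car A s"
    by (simp add: free_map_surj)
  ultimately show ?thesis
    using algebra_A free_map_hom unfolding HSP_def H_closure_def by blast
qed

end

theorem theorem7p4:
  fixes \<kappa> :: "'k rel"
    and M :: "('k, 's, 'f) clone"
    and K :: "('k, 's, 'f, 'u) algebra set"
  assumes "Cinfinite \<kappa>"
    and "regularCard \<kappa>"
    and "|UNIV :: 's set| <o \<kappa>"
    and "is_clone \<kappa> M"
    and "pure \<kappa> M"
    and "\<forall>B\<in>K. is_algebra \<kappa> M B"
  shows "(variety \<kappa> M K :: ('k, 's, 'f, 'a) algebra set) =
           HSP \<kappa> M TYPE(('k, 's, 'f, 'u, 'a) valuation_index) K \<and>
         (HSP \<kappa> M TYPE('i) K :: ('k, 's, 'f, 'a) algebra set) \<subseteq> variety \<kappa> M K"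
\<comment> \<open>\<open>HSP_subset_variety\<close> settles both inclusions into the variety, as it
  holds for every index type. Only the construction for a given \<open>A\<close> in the variety
  remains.\<close>
proof (intro conjI equalityI HSP_subset_variety subsetI)
  fix A :: "('k, 's, 'f, 'a) algebra"
  assume A: "A \<in> variety \<kappa> M K"
  then have "is_algebra \<kappa> M A"
    by (simp add: variety_def)
  then have "variety_member \<kappa> M A K"
    using assms A by (simp add: variety_member_def variety_member_axioms_def)
  then show "A \<in> HSP \<kappa> M TYPE(('k, 's, 'f, 'u, 'a) valuation_index) K"
    by (rule variety_member.in_HSP)
qed

end
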